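(* Let $q$ be a prime power and $1\le\ell\le m$ integers. For $r=1,\dots,m$, the $r$-th generalized Hamming weight $\hat d_r$ of $\hat C_{\det}(1;\ell,m)$ meets the Griesmer–Wei bound and is given by $$\hat d_r=q^{\ell+m-2}+q^{\ell+m-3}+\cdots+q^{\ell+m-r-1}=q^{\ell+m-r-1}\frac{q^r-1}{q-1}.$$ In particular, if $r\le\ell$, then $\hat d_r=\hat w_r$, where $\hat w_r=w_H(\hat c_{\tau_r})$ with $\tau_r=X_{11}+\cdots+X_{rr}$.
   Context: $\mathbb{F}_q$ is the finite field with $q$ elements; $X=(X_{ij})$ is an $\ell\times m$ matrix of indeterminates; $\mathbb{F}_q[X]_1$ is the space of linear homogeneous polynomials $f=\sum f_{ij}X_{ij}$ (with $0$), evaluated at a matrix $M$ by $f(M)=\sum f_{ij}M_{ij}$. Let $\hat M_1,\dots,\hat M_{\hat n}$ be representatives, one from each class of nonzero scalar multiples, of the matrices in $M_{\ell\times m}(\mathbb{F}_q)$ of rank exactly $1$; $\hat c_f=(f(\hat M_1),\dots,f(\hat M_{\hat n}))$ and $\hat C_{\det}(1;\ell,m)=\{\hat c_f\}$. $w_H$ is Hamming weight. For a code $C$, the support weight of a subcode $D$ is $\|D\|=|\{i:\exists c\in D,\ c_i\neq0\}|$ and $d_r(C)=\min\{\|D\|:D\subseteq C,\ \dim D=r\}$. The Griesmer–Wei bound is $d_r\ge\sum_{j=0}^{r-1}\lceil d_1/q^j\rceil$. *)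

theory Defs
  imports "HOL-Analysis.Analysis"
begin

section \<open>Linear codes\<close>

text \<open>A code of length \<open>CARD('n)\<close> is a set of vectors in \<^typ>\<open>'a ^ 'n\<close>; the coordinate
  positions are the elements of the finite type \<open>'n\<close>.\<close>

definition hamming_weight :: "'a::field ^ 'n \<Rightarrow> nat" where
  "hamming_weight c = card {i. c $ i \<noteq> 0}"

definition support_weight :: "('a::field ^ 'n) set \<Rightarrow> nat" where
  "support_weight D = card {i. \<exists>c\<in>D. c $ i \<noteq> 0}"

text \<open>Like the notion it formalizes, this is meaningful only if \<open>C\<close> has a subcode of dimension
  \<open>r\<close>; otherwise it is the unspecified value \<open>Min {}\<close>.\<close>

definition generalized_hamming_weight :: "nat \<Rightarrow> ('a::field ^ 'n) set \<Rightarrow> nat" where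
  "generalized_hamming_weight r C =
     Min {support_weight D | D. vec.subspace D \<and> D \<subseteq> C \<and> vec.dim D = r}"

definition griesmer_wei_bound :: "nat \<Rightarrow> ('a::{field, finite} ^ 'n) set \<Rightarrow> int" where
  "griesmer_wei_bound r C =
     (\<Sum>j<r. \<lceil>real (generalized_hamming_weight 1 C) / real (CARD('a) ^ j)\<rceil>)"

section \<open>Linear forms on matrices and the code\<close>

text \<open>A homogeneous linear polynomial \<open>\<Sum> f\<^sub>i\<^sub>j X\<^sub>i\<^sub>j\<close> in the entries of an
  \<open>\<ell> \<times> m\<close> matrix of indeterminates is represented by its coefficient matrix \<open>(f\<^sub>i\<^sub>j)\<close>. Rows are
  indexed by \<open>'l\<close> and columns by \<open>'m\<close>, so \<open>\<ell> = CARD('l)\<close> and \<open>m = CARD('m)\<close>.\<close>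

definition indet :: "'l \<Rightarrow> 'm \<Rightarrow> 'a::field ^ 'm::finite ^ 'l::finite" where
  "indet i j = axis i (axis j 1)"

definition eval_form :: "'a::field ^ 'm ^ 'l \<Rightarrow> 'a ^ 'm ^ 'l \<Rightarrow> 'a" where
  "eval_form f M = (\<Sum>i\<in>UNIV. \<Sum>j\<in>UNIV. f $ i $ j * M $ i $ j)"

definition scalar_multiple :: "'a::field \<Rightarrow> 'a ^ 'm ^ 'l \<Rightarrow> 'a ^ 'm ^ 'l" where
  "scalar_multiple c M = (\<chi> i j. c * M $ i $ j)"

text \<open>The family \<open>Mh\<close> contains exactly one matrix from each class of rank one matrices modulo
  multiplication by nonzero scalars.\<close>

definition rank_one_representatives :: "('n \<Rightarrow> 'a::field ^ 'm ^ 'l) \<Rightarrow> bool" where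
  "rank_one_representatives Mh \<longleftrightarrow>
     (\<forall>i. rank (Mh i) = 1) \<and>
     (\<forall>M. rank M = 1 \<longrightarrow> (\<exists>!i. \<exists>c. c \<noteq> 0 \<and> M = scalar_multiple c (Mh i)))"

definition codeword ::
    "('n \<Rightarrow> 'a::field ^ 'm ^ 'l) \<Rightarrow> 'a ^ 'm ^ 'l \<Rightarrow> 'a ^ 'n" where
  "codeword Mh f = (\<chi> i. eval_form f (Mh i))"

definition det_code :: "('n \<Rightarrow> 'a::field ^ 'm ^ 'l) \<Rightarrow> ('a ^ 'n) set" where
  "det_code Mh = range (codeword Mh)"

text \<open>The index types carry no order, so the form \<open>X\<^sub>1\<^sub>1 + \<dots> + X\<^sub>r\<^sub>r\<close> is taken with respect to
  enumerations \<open>\<rho>\<close> and \<open>\<gamma>\<close> (starting at \<open>1\<close>) of the row and column indices.\<close>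

definition diag_form ::
    "(nat \<Rightarrow> 'l) \<Rightarrow> (nat \<Rightarrow> 'm) \<Rightarrow> nat \<Rightarrow> 'a::field ^ 'm::finite ^ 'l::finite" where
  "diag_form \<rho> \<gamma> r = (\<Sum>k=1..r. indet (\<rho> k) (\<gamma> k))"

end

theory Submission
  imports Defs
begin

text \<open>A rank one matrix is \<open>u v\<^sup>T\<close>, and a form \<open>f\<close> takes the value \<open>u\<^sup>T f v\<close> there, so counting
  pairs \<open>(u, v)\<close> shows that the weight of \<open>c\<^sub>f\<close> is \<open>q\<^sup>\<ell>\<^sup>-\<^sup>1\<close> times the number of \<open>v\<close> with \<open>f v \<noteq> 0\<close>,
  divided by \<open>q - 1\<close>. Hence every nonzero codeword has weight at least \<open>q\<^sup>\<ell>\<^sup>+\<^sup>m\<^sup>-\<^sup>2\<close>, with equality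
  for forms involving a single row. The lower bound on the support weight of an
  \<open>r\<close>-dimensional subcode follows because \<open>(q - 1) q\<^sup>r\<^sup>-\<^sup>1\<close> times the support weight is the sum of
  the weights of all its codewords; a subcode of forms involving a single row attains it.\<close>

section \<open>Counting in vector spaces over a finite field\<close>

lemma one_less_CARD_field: "1 < CARD('a::{field, finite})"
proof -
  have "card {0, 1::'a} \<le> CARD('a)" by (intro card_mono) auto
  then show ?thesis by simp
qed

text \<open>A nonzero functional takes the value 1 at some \<open>s\<close> in \<open>D\<close>, and
  \<open>D\<close> is the direct sum of the kernel and the line through \<open>s\<close>. All fibres
  of \<open>\<phi>\<close> are therefore translates of the kernel.\<close>

lemma
  fixes D :: "('a::{field, finite} ^ 'n::finite) set" and \<phi> :: "'a ^ 'n \<Rightarrow> 'a"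
  assumes D: "vec.subspace D"
    and add: "\<And>x y. \<phi> (x + y) = \<phi> x + \<phi> y"
    and scale: "\<And>c x. \<phi> (c *s x) = c * \<phi> x"
    and ex: "\<exists>x\<in>D. \<phi> x \<noteq> 0"
  shows card_functional_eq_0: "CARD('a) * card {x \<in> D. \<phi> x = 0} = card D"
    and card_functional_neq_0: "CARD('a) * card {x \<in> D. \<phi> x \<noteq> 0} = (CARD('a) - 1) * card D"
proof -
  let ?K = "{x \<in> D. \<phi> x = 0}"
  obtain x where x: "x \<in> D" "\<phi> x \<noteq> 0" using ex by blast
  define s where "s = (1 / \<phi> x) *s x"
  have s: "s \<in> D" "\<phi> s = 1"
    using x D by (simp_all add: s_def scale vec.subspace_scale)
  have \<phi>: "\<phi> (k + a *s s) = a" if "k \<in> ?K" for a k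
    using that by (simp add: add scale s)
  \<comment> \<open>Taking an arbitrary set \<open>A\<close> of values covers both claims:
    \<open>UNIV\<close> gives the first and \<open>- {0}\<close> the second.\<close>
  have fibres: "card {y \<in> D. \<phi> y \<in> A} = card A * card ?K" for A
  proof -
    have "bij_betw (\<lambda>(a, k). k + a *s s) (A \<times> ?K) {y \<in> D. \<phi> y \<in> A}"
    proof (rule bij_betwI')
      fix p p' assume p: "p \<in> A \<times> ?K" "p' \<in> A \<times> ?K"
      obtain a k a' k' where ak: "p = (a, k)" "p' = (a', k')" by (cases p; cases p')
      have "a = a'" if "k + a *s s = k' + a' *s s"
        using \<phi>[of k a] \<phi>[of k' a'] that p ak by simp
      then show "((case p of (a, k) \<Rightarrow> k + a *s s) = (case p' of (a, k) \<Rightarrow> k + a *s s)) = (p = p')"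
        using ak by auto
    next
      fix p assume "p \<in> A \<times> ?K"
      then show "(case p of (a, k) \<Rightarrow> k + a *s s) \<in> {y \<in> D. \<phi> y \<in> A}"
        using \<phi> D s by (auto intro!: vec.subspace_add vec.subspace_scale)
    next
      fix y assume y: "y \<in> {y \<in> D. \<phi> y \<in> A}"
      have "\<phi> (y - \<phi> y *s s) = 0"
        using add[of "y - \<phi> y *s s" "\<phi> y *s s"] by (simp add: scale s)
      moreover have "y - \<phi> y *s s \<in> D"
        using y s D by (auto intro!: vec.subspace_diff vec.subspace_scale)
      ultimately show "\<exists>p\<in>A \<times> ?K. y = (case p of (a, k) \<Rightarrow> k + a *s s)"
        using y by (intro bexI[of _ "(\<phi> y, y - \<phi> y *s s)"]) auto
    qed
    then show ?thesis
      using bij_betw_same_card[of _ "A \<times> ?K"] by (fastforce simp: card_cartesian_product)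
  qed
  show eq: "CARD('a) * card ?K = card D" using fibres[of UNIV] by simp
  have "card {y \<in> D. \<phi> y \<noteq> 0} = (CARD('a) - 1) * card ?K"
    using fibres[of "- {0}"] by (simp add: Compl_eq_Diff_UNIV card_Diff_subset)
  then show "CARD('a) * card {x \<in> D. \<phi> x \<noteq> 0} = (CARD('a) - 1) * card D"
    by (simp flip: eq)
qed

text \<open>Adjoining a vector \<open>b\<close> outside the span multiplies the size by
  \<open>q\<close>, since each element of the larger span is \<open>x + k *s b\<close> for exactly
  one pair \<open>(k, x)\<close>.\<close>

lemma card_span_independent:
  fixes B :: "('a::{field, finite} ^ 'n::finite) set"
  assumes "vec.independent B"
  shows "card (vec.span B) = CARD('a) ^ card B"
proof -
  have "finite B" by simp
  then show ?thesis using assms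
  proof (induction B rule: finite_induct)
    case empty
    then show ?case by simp
  next
    case (insert b B)
    then have B: "vec.independent B" and b: "b \<notin> vec.span B"
      by (auto simp: vec.independent_insert)
    have "bij_betw (\<lambda>(k, x). x + k *s b) (UNIV \<times> vec.span B) (vec.span (insert b B))"
    proof (rule bij_betwI')
      fix p p' :: "'a \<times> ('a ^ 'n)"
      assume p: "p \<in> UNIV \<times> vec.span B" "p' \<in> UNIV \<times> vec.span B"
      obtain k x k' x' where kx: "p = (k, x)" "p' = (k', x')" by (cases p; cases p')
      have "p = p'" if eq: "x + k *s b = x' + k' *s b"
      proof (rule ccontr)
        assume "p \<noteq> p'"
        then have "k \<noteq> k'" using eq kx by auto
        \<comment> \<open>Two different coefficients would put \<open>b\<close> into
          \<open>vec.span B\<close>.\<close>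
        moreover have "(k' - k) *s b = x - x'"
          using eq by (simp add: vec.scale_left_diff_distrib algebra_simps)
        ultimately have "b = (1 / (k' - k)) *s (x - x')"
          by (metis diff_eq_diff_eq eq_iff_diff_eq_0 nonzero_eq_divide_eq vec.scale_one vec.scale_scale)
        then show False using b p kx by (auto intro: vec.span_scale vec.span_diff)
      qed
      then show "((case p of (k, x) \<Rightarrow> x + k *s b) = (case p' of (k, x) \<Rightarrow> x + k *s b)) = (p = p')"
        using kx by auto
    next
      fix p :: "'a \<times> ('a ^ 'n)"
      assume "p \<in> UNIV \<times> vec.span B"
      then show "(case p of (k, x) \<Rightarrow> x + k *s b) \<in> vec.span (insert b B)"
        by (cases p) (auto simp: vec.span_insert intro: exI[of _ "fst p"])
    next
      fix y assume "y \<in> vec.span (insert b B)"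
      then obtain k where "y - k *s b \<in> vec.span B" by (auto simp: vec.span_insert)
      then show "\<exists>p\<in>UNIV \<times> vec.span B. y = (case p of (k, x) \<Rightarrow> x + k *s b)"
        by (intro bexI[of _ "(k, y - k *s b)"]) auto
    qed
    then have "card (vec.span (insert b B)) = CARD('a) * card (vec.span B)"
      using bij_betw_same_card by (fastforce simp: card_cartesian_product)
    then show ?case using insert B by simp
  qed
qed

lemma card_subspace:
  fixes D :: "('a::{field, finite} ^ 'n::finite) set"
  assumes "vec.subspace D"
  shows "card D = CARD('a) ^ vec.dim D"
proof -
  obtain B where B: "B \<subseteq> D" "vec.independent B" "D \<subseteq> vec.span B" "card B = vec.dim D"
    using vec.basis_exists by blast
  then have "vec.span B = D" using assms vec.span_subspace by blast
  then show ?thesis using B card_span_independent by metis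
qed

lemma card_scalar_product_neq_0:
  fixes w :: "'a::{field, finite} ^ 'n::finite"
  assumes "w \<noteq> 0"
  shows "card {u. (\<Sum>i\<in>UNIV. u $ i * w $ i) \<noteq> 0} = (CARD('a) - 1) * CARD('a) ^ (CARD('n) - 1)"
proof -
  obtain j where j: "w $ j \<noteq> 0" using assms by (auto simp: vec_eq_iff)
  \<comment> \<open>The unit vector at a nonzero coordinate of \<open>w\<close> witnesses that the
    functional is not zero.\<close>
  have "(\<Sum>i\<in>UNIV. axis j 1 $ i * w $ i) = (\<Sum>i\<in>UNIV. if i = j then w $ j else 0)"
    by (intro sum.cong) (auto simp: axis_def)
  then have "(\<Sum>i\<in>UNIV. axis j 1 $ i * w $ i) \<noteq> 0" using j by simp
  then have "CARD('a) * card {u \<in> UNIV. (\<Sum>i\<in>UNIV. u $ i * w $ i) \<noteq> 0}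
      = (CARD('a) - 1) * card (UNIV :: ('a ^ 'n) set)"
    by (intro card_functional_neq_0)
      (auto simp: sum.distrib sum_distrib_left algebra_simps)
  also have "\<dots> = CARD('a) * ((CARD('a) - 1) * CARD('a) ^ (CARD('n) - 1))"
    by (cases "CARD('n)") auto
  finally show ?thesis by simp
qed

text \<open>Each new coordinate \<open>j\<close> is a nonzero functional on the subspace reached so
  far, because \<open>axis j 1\<close> satisfies all earlier conditions. So each condition divides
  the count by \<open>q\<close>; the product form avoids subtracting exponents.\<close>

lemma card_vanishing_coordinates:
  fixes J :: "'n::finite set"
  shows "CARD('a::{field, finite}) ^ card J * card {v :: 'a ^ 'n. \<forall>j\<in>J. v $ j = 0}
    = CARD('a) ^ CARD('n)"
proof -
  have "finite J" by simp
  then show ?thesis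
  proof (induction J rule: finite_induct)
    case empty
    then show ?case by simp
  next
    case (insert j J)
    let ?D = "{v :: 'a ^ 'n. \<forall>j\<in>J. v $ j = 0}"
    have "vec.subspace ?D" by (auto simp: vec.subspace_def)
    moreover have "axis j 1 \<in> ?D" using insert by (auto simp: axis_def)
    ultimately have "CARD('a) * card {v \<in> ?D. v $ j = 0} = card ?D"
      by (intro card_functional_eq_0) (auto intro!: bexI[of _ "axis j 1"])
    moreover have "{v \<in> ?D. v $ j = 0} = {v. \<forall>j\<in>insert j J. v $ j = 0}" by auto
    ultimately have "CARD('a) * card {v :: 'a ^ 'n. \<forall>j\<in>insert j J. v $ j = 0} = card ?D"
      by (simp only:)
    then show ?case
      by (simp only: card_insert_disjoint[OF insert.hyps] power_Suc2 mult.assoc insert.IH)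
  qed
qed

section \<open>Support weights and Hamming weights\<close>

text \<open>Double counting of the pairs \<open>(c, i)\<close> with \<open>c $ i \<noteq> 0\<close>.
  A coordinate in the support is a nonzero functional on \<open>D\<close>, hence nonzero on exactly
  the fraction \<open>(q - 1) / q\<close> of \<open>D\<close>; any other coordinate contributes
  nothing.\<close>

lemma support_weight_eq_sum_hamming_weight:
  fixes D :: "('a::{field, finite} ^ 'n::finite) set"
  assumes D: "vec.subspace D"
  shows "CARD('a) * (\<Sum>c\<in>D. hamming_weight c) = (CARD('a) - 1) * card D * support_weight D"
proof -
  let ?S = "{i. \<exists>c\<in>D. c $ i \<noteq> 0}"
  have "(\<Sum>c\<in>D. hamming_weight c) = (\<Sum>c\<in>D. \<Sum>i\<in>UNIV. if c $ i \<noteq> 0 then 1 else 0)"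
    by (simp add: hamming_weight_def sum.If_cases)
  also have "\<dots> = (\<Sum>i\<in>UNIV. \<Sum>c\<in>D. if c $ i \<noteq> 0 then 1 else 0)"
    by (rule sum.swap)
  also have "\<dots> = (\<Sum>i\<in>UNIV. card {c \<in> D. c $ i \<noteq> 0})"
    by (intro sum.cong) (auto simp: sum.If_cases Int_def)
  also have "CARD('a) * \<dots> = (\<Sum>i\<in>UNIV. if i \<in> ?S then (CARD('a) - 1) * card D else 0)"
    unfolding sum_distrib_left
  proof (intro sum.cong refl)
    fix i :: 'n
    show "CARD('a) * card {c \<in> D. c $ i \<noteq> 0} = (if i \<in> ?S then (CARD('a) - 1) * card D else 0)"
    proof (cases "i \<in> ?S")
      case True
      then show ?thesis using card_functional_neq_0[OF D, of "\<lambda>c. c $ i"] by auto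
    next
      case False
      then have "{c \<in> D. c $ i \<noteq> 0} = {}" by auto
      then show ?thesis using False by (simp only: card.empty) auto
    qed
  qed
  also have "\<dots> = (CARD('a) - 1) * card D * support_weight D"
    by (simp add: support_weight_def sum.If_cases)
  finally show ?thesis .
qed

text \<open>One factor \<open>q\<close> of \<open>card D\<close> cancels. The zero word has weight 0
  and is dropped, so that a bound on the weights of nonzero words applies to every summand.\<close>

lemma sum_hamming_weight_subspace:
  fixes D :: "('a::{field, finite} ^ 'n::finite) set"
  assumes D: "vec.subspace D" and r: "vec.dim D = Suc k"
  shows "(\<Sum>c\<in>D - {0}. hamming_weight c) = (CARD('a) - 1) * CARD('a) ^ k * support_weight D"
proof -
  have "(\<Sum>c\<in>D. hamming_weight c) = (\<Sum>c\<in>D - {0}. hamming_weight c)"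
    by (intro sum.mono_neutral_right) (auto simp: hamming_weight_def)
  moreover have "card D = CARD('a) * CARD('a) ^ k" using card_subspace[OF D] r by simp
  ultimately show ?thesis
    using support_weight_eq_sum_hamming_weight[OF D] by simp
qed

section \<open>Rank one matrices\<close>

definition outer :: "'a::field ^ 'l \<Rightarrow> 'a ^ 'm \<Rightarrow> 'a ^ 'm ^ 'l" where
  "outer u v = (\<chi> i j. u $ i * v $ j)"

lemma rank_outer:
  fixes u :: "'a::field ^ 'l::finite" and v :: "'a ^ 'm::finite"
  assumes "u \<noteq> 0" "v \<noteq> 0"
  shows "rank (outer u v) = 1"
proof -
  have row: "row i (outer u v) = u $ i *s v" for i
    by (simp add: row_def outer_def vec_eq_iff)
  have "rows (outer u v) \<subseteq> vec.span {v}"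
    by (auto simp: rows_def row intro: vec.span_scale vec.span_base)
  then have "rank (outer u v) \<le> 1"
    unfolding row_rank_def_gen using vec.dim_le_card[of "rows (outer u v)" "{v}"] by simp
  moreover obtain i where "u $ i \<noteq> 0" using assms by (auto simp: vec_eq_iff)
  then have "u $ i *s v \<in> rows (outer u v)" "u $ i *s v \<noteq> 0"
    using assms by (auto simp: rows_def simp flip: row)
      (auto simp: row)
  then have "rank (outer u v) \<noteq> 0"
    unfolding row_rank_def_gen vec.dim_eq_0 by auto
  ultimately show ?thesis by simp
qed

text \<open>The row space is spanned by one vector \<open>v\<close>; the coefficients of the rows
  with respect to \<open>v\<close> form \<open>u\<close>.\<close>

lemma rank_one_outer:
  fixes M :: "'a::field ^ 'm::finite ^ 'l::finite"
  assumes "rank M = 1"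
  obtains u v where "u \<noteq> 0" "v \<noteq> 0" "M = outer u v"
proof -
  obtain B where B: "rows M \<subseteq> vec.span B" "card B = 1" "vec.independent B"
    using vec.basis_exists[of "rows M"] assms unfolding row_rank_def_gen by metis
  then obtain v where v: "B = {v}" by (auto simp: card_1_singleton_iff)
  have "\<exists>c. M $ i = c *s v" for i
  proof -
    have "row i M \<in> vec.span {v}" using B v by (auto simp: rows_def)
    then show ?thesis
      by (auto simp: vec.span_singleton row_def)
  qed
  then obtain c where c: "\<And>i. M $ i = c i *s v" by metis
  then have M: "M = outer (\<chi> i. c i) v" by (simp add: outer_def vec_eq_iff)
  have "rows M \<noteq> {0}" "rows M \<noteq> {}"
    using assms vec.dim_eq_0[of "rows M"] unfolding row_rank_def_gen by auto
  then have "M \<noteq> 0" by (auto simp: rows_def row_def vec_eq_iff)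
  then have "(\<chi> i. c i) \<noteq> 0" "v \<noteq> 0" using c by (auto simp: vec_eq_iff)
  then show thesis using that M by blast
qed

lemma eval_form_outer:
  "eval_form f (outer u v) = (\<Sum>i\<in>UNIV. u $ i * (f *v v) $ i)"
  by (simp add: eval_form_def outer_def matrix_vector_mult_def sum_distrib_left mult.left_commute)

lemma eval_form_scalar_multiple:
  "eval_form f (scalar_multiple c M) = c * eval_form f M"
  by (simp add: eval_form_def scalar_multiple_def sum_distrib_left mult.left_commute)

text \<open>The two factors are determined up to scalars: comparing the matrices along a column
  \<open>j\<close> with \<open>v $ j \<noteq> 0\<close> relates \<open>u\<close> to
  \<open>u'\<close>, and along a row \<open>i\<close> with \<open>u $ i \<noteq> 0\<close> relates
  \<open>v\<close> to \<open>v'\<close>.\<close>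

lemma outer_eq_scalar_multiple:
  fixes u u' :: "'a::field ^ 'l::finite" and v v' :: "'a ^ 'm::finite"
  assumes "u \<noteq> 0" "v \<noteq> 0" and eq: "outer u v = scalar_multiple c (outer u' v')"
  obtains a b where "a \<noteq> 0" "b \<noteq> 0" "u = a *s u'" "v = b *s v'"
proof -
  obtain i j where ij: "u $ i \<noteq> 0" "v $ j \<noteq> 0" using assms by (auto simp: vec_eq_iff)
  have e: "u $ i * v $ j = c * (u' $ i * v' $ j)" for i j
    using eq by (simp add: outer_def scalar_multiple_def vec_eq_iff)
  have "c * u' $ i / u $ i \<noteq> 0" "c * v' $ j / v $ j \<noteq> 0" using e[of i j] ij by auto
  moreover have "u = (c * v' $ j / v $ j) *s u'" "v = (c * u' $ i / u $ i) *s v'"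
    using e[of _ j] e[of i] ij by (auto simp: vec_eq_iff field_simps)
  ultimately show thesis using that by blast
qed

section \<open>Weights of codewords\<close>

text \<open>Fix a factorization of each representative into \<open>U i\<close> and
  \<open>V i\<close>. A pair on which the form does not vanish is
  \<open>(a *s U i, b *s V i)\<close> for unique nonzero \<open>a\<close>, \<open>b\<close> and a
  unique \<open>i\<close> in the support of the codeword, so each such \<open>i\<close> accounts for
  \<open>(q - 1)^2\<close> pairs.\<close>

lemma card_pairs_eq_hamming_weight:
  fixes Mh :: "'n::finite \<Rightarrow> 'a::{field, finite} ^ 'm::finite ^ 'l::finite"
  assumes reps: "rank_one_representatives Mh"
  shows "card {(u, v). eval_form f (outer u v) \<noteq> 0}
    = (CARD('a) - 1) * (CARD('a) - 1) * hamming_weight (codeword Mh f)"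
proof -
  have "\<exists>u v. u \<noteq> 0 \<and> v \<noteq> 0 \<and> Mh i = outer u v" for i
    using reps rank_one_outer unfolding rank_one_representatives_def by metis
  then obtain U V where UV: "\<And>i. U i \<noteq> 0" "\<And>i. V i \<noteq> 0" "\<And>i. Mh i = outer (U i) (V i)"
    by metis
  have scale: "outer (a *s U i) (b *s V i) = scalar_multiple (a * b) (Mh i)" for a b i
    by (simp add: UV(3) outer_def scalar_multiple_def vec_eq_iff)
  let ?S = "{i. codeword Mh f $ i \<noteq> 0}"
  let ?h = "\<lambda>((a, b), i). (a *s U i, b *s V i)"
  have "bij_betw ?h (((- {0}) \<times> (- {0})) \<times> ?S)
      {(u, v). eval_form f (outer u v) \<noteq> 0}"
  proof (rule bij_betwI')
    fix p p' :: "('a \<times> 'a) \<times> 'n"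
    assume p: "p \<in> ((- {0}) \<times> (- {0})) \<times> ?S" "p' \<in> ((- {0}) \<times> (- {0})) \<times> ?S"
    obtain a b i a' b' i' where pe: "p = ((a, b), i)" "p' = ((a', b'), i')"
      by (metis prod.collapse)
    have "p = p'" if eq: "a *s U i = a' *s U i'" "b *s V i = b' *s V i'"
    proof -
      have "a * b \<noteq> 0" "a' * b' \<noteq> 0" using p pe by auto
      moreover have "outer (a *s U i) (b *s V i) = scalar_multiple (a * b) (Mh i)"
        "outer (a *s U i) (b *s V i) = scalar_multiple (a' * b') (Mh i')"
        using scale[of a i b] scale[of a' i' b'] by (simp_all only: eq)
      \<comment> \<open>The same rank one matrix lies in the classes of \<open>Mh i\<close> and
        \<open>Mh i'\<close>, so uniqueness of the representative yields
        \<open>i = i'\<close>.\<close>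
      moreover have "rank (outer (a *s U i) (b *s V i)) = 1"
        using p pe UV by (intro rank_outer) auto
      ultimately have "i = i'"
        using reps unfolding rank_one_representatives_def by blast
      moreover from this have "a = a'" "b = b'" using eq UV(1,2) by auto
      ultimately show ?thesis using pe by simp
    qed
    then show "(?h p = ?h p') = (p = p')"
      using pe by auto
  next
    fix p :: "('a \<times> 'a) \<times> 'n"
    assume "p \<in> ((- {0}) \<times> (- {0})) \<times> ?S"
    then show "?h p \<in> {(u, v). eval_form f (outer u v) \<noteq> 0}"
      by (auto simp: scale eval_form_scalar_multiple codeword_def)
  next
    fix z :: "('a ^ 'l) \<times> ('a ^ 'm)"
    assume z: "z \<in> {(u, v). eval_form f (outer u v) \<noteq> 0}"
    obtain u v where uv: "z = (u, v)" by (cases z)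
    have "u \<noteq> 0" "v \<noteq> 0" using z uv by (auto simp: eval_form_def outer_def)
    then obtain i c where i: "c \<noteq> 0" "outer u v = scalar_multiple c (Mh i)"
      using reps rank_outer unfolding rank_one_representatives_def by metis
    then obtain a b where ab: "a \<noteq> 0" "b \<noteq> 0" "u = a *s U i" "v = b *s V i"
      using outer_eq_scalar_multiple[OF \<open>u \<noteq> 0\<close> \<open>v \<noteq> 0\<close>] UV(3) by metis
    have "i \<in> ?S" using z uv i by (auto simp: codeword_def eval_form_scalar_multiple)
    then show "\<exists>p\<in>((- {0}) \<times> (- {0})) \<times> ?S. z = ?h p"
      using ab uv by (intro bexI[of _ "((a, b), i)"]) auto
  qed
  from bij_betw_same_card[OF this] show ?thesis
    by (simp add: card_cartesian_product Compl_eq_Diff_UNIV card_Diff_subset hamming_weight_def)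
qed

lemma hamming_weight_codeword:
  fixes Mh :: "'n::finite \<Rightarrow> 'a::{field, finite} ^ 'm::finite ^ 'l::finite"
  assumes reps: "rank_one_representatives Mh"
  shows "(CARD('a) - 1) * hamming_weight (codeword Mh f)
    = CARD('a) ^ (CARD('l) - 1) * card {v. f *v v \<noteq> 0}"
proof -
  let ?A = "\<lambda>v. {u. (\<Sum>i\<in>UNIV. u $ i * (f *v v) $ i) \<noteq> 0}"
  \<comment> \<open>With \<open>v\<close> fixed first, the value of the form is the scalar product
    of \<open>u\<close> with the constant vector \<open>f *v v\<close>.\<close>
  have "{(u, v). eval_form f (outer u v) \<noteq> 0} = prod.swap ` (SIGMA v:UNIV. ?A v)"
    unfolding eval_form_outer by force
  then have "card {(u, v). eval_form f (outer u v) \<noteq> 0} = card (SIGMA v:UNIV. ?A v)"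
    by (simp only: card_image inj_swap)
  also have "\<dots> = (\<Sum>v\<in>UNIV. card (?A v))" by simp
  also have "\<dots> = (\<Sum>v\<in>UNIV. if f *v v \<noteq> 0 then (CARD('a) - 1) * CARD('a) ^ (CARD('l) - 1) else 0)"
    by (intro sum.cong) (auto simp: card_scalar_product_neq_0)
  also have "\<dots> = (CARD('a) - 1) * (CARD('a) ^ (CARD('l) - 1) * card {v. f *v v \<noteq> 0})"
    by (simp add: sum.If_cases)
  finally show ?thesis
    using one_less_CARD_field[where ?'a = 'a] by (simp add: card_pairs_eq_hamming_weight[OF reps])
qed

text \<open>It suffices to look at one nonzero row \<open>f $ i\<close>: whenever its scalar product
  with \<open>v\<close> is nonzero, so is \<open>f *v v\<close>.\<close>

lemma hamming_weight_codeword_ge: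
  fixes Mh :: "'n::finite \<Rightarrow> 'a::{field, finite} ^ 'm::finite ^ 'l::finite"
  assumes reps: "rank_one_representatives Mh" and "f \<noteq> 0"
  shows "CARD('a) ^ (CARD('l) - 1 + (CARD('m) - 1)) \<le> hamming_weight (codeword Mh f)"
proof -
  obtain i where i: "f $ i \<noteq> 0" using assms by (auto simp: vec_eq_iff)
  have "(\<Sum>j\<in>UNIV. v $ j * f $ i $ j) = (f *v v) $ i" for v
    by (simp add: matrix_vector_mult_def mult.commute)
  then have "{v. (\<Sum>j\<in>UNIV. v $ j * f $ i $ j) \<noteq> 0} \<subseteq> {v. f *v v \<noteq> 0}"
    by auto
  then have "card {v. (\<Sum>j\<in>UNIV. v $ j * f $ i $ j) \<noteq> 0} \<le> card {v. f *v v \<noteq> 0}"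
    by (intro card_mono) auto
  then have "(CARD('a) - 1) * CARD('a) ^ (CARD('m) - 1) \<le> card {v. f *v v \<noteq> 0}"
    using card_scalar_product_neq_0[OF i] by simp
  then have "(CARD('a) - 1) * (CARD('a) ^ (CARD('l) - 1) * CARD('a) ^ (CARD('m) - 1))
      \<le> (CARD('a) - 1) * hamming_weight (codeword Mh f)"
    unfolding hamming_weight_codeword[OF reps] mult.left_commute[of "CARD('a) - 1"]
    by (intro mult_le_mono2)
  then show ?thesis
    using one_less_CARD_field[where ?'a = 'a] unfolding power_add by simp
qed

text \<open>With only row \<open>i\<close> present, \<open>f *v v\<close> is nonzero exactly when
  \<open>w\<close> and \<open>v\<close> have nonzero scalar product, so the estimate for general
  forms becomes an equality.\<close>

lemma hamming_weight_codeword_axis: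
  fixes Mh :: "'n::finite \<Rightarrow> 'a::{field, finite} ^ 'm::finite ^ 'l::finite"
  assumes reps: "rank_one_representatives Mh" and "w \<noteq> 0"
  shows "hamming_weight (codeword Mh (axis i w)) = CARD('a) ^ (CARD('l) - 1 + (CARD('m) - 1))"
proof -
  have "(axis i w *v v) $ k = (if k = i then \<Sum>j\<in>UNIV. v $ j * w $ j else 0)" for v k
    by (simp add: matrix_vector_mult_def axis_def mult.commute)
  then have "{v. axis i w *v v \<noteq> 0} = {v. (\<Sum>j\<in>UNIV. v $ j * w $ j) \<noteq> 0}"
    by (auto simp: vec_eq_iff)
  then have "(CARD('a) - 1) * hamming_weight (codeword Mh (axis i w))
      = (CARD('a) - 1) * (CARD('a) ^ (CARD('l) - 1) * CARD('a) ^ (CARD('m) - 1))"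
    unfolding hamming_weight_codeword[OF reps]
    by (simp only: card_scalar_product_neq_0[OF \<open>w \<noteq> 0\<close>] mult.left_commute)
  then show ?thesis
    using one_less_CARD_field[where ?'a = 'a] unfolding power_add by simp
qed

text \<open>The product \<open>f *v v\<close> carries the entry \<open>v $ \<gamma> k\<close> at
  position \<open>\<rho> k\<close> and zeros elsewhere. It vanishes iff \<open>r\<close> prescribed
  coordinates of \<open>v\<close> do, which leaves \<open>q^m - q^(m-r)\<close> vectors to
  count.\<close>

lemma hamming_weight_codeword_diag_form:
  fixes Mh :: "'n::finite \<Rightarrow> 'a::{field, finite} ^ 'm::finite ^ 'l::finite"
  assumes reps: "rank_one_representatives Mh"
    and \<rho>: "inj_on \<rho> {1..r}" and \<gamma>: "inj_on \<gamma> {1..r}" and r: "r \<le> CARD('m)"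
  shows "(CARD('a) - 1) * hamming_weight (codeword Mh (diag_form \<rho> \<gamma> r))
    = CARD('a) ^ (CARD('l) - 1 + (CARD('m) - r)) * (CARD('a) ^ r - 1)"
proof -
  let ?f = "diag_form \<rho> \<gamma> r :: 'a ^ 'm ^ 'l"
  have entry: "(indet i j *v v) $ k = (if k = i then v $ j else 0)" for i j k and v :: "'a ^ 'm"
  proof -
    have "(\<Sum>j'\<in>UNIV. axis j 1 $ j' * v $ j') = (\<Sum>j'\<in>UNIV. if j' = j then v $ j' else 0)"
      by (intro sum.cong) (auto simp: axis_def)
    then show ?thesis by (simp add: indet_def matrix_vector_mult_def axis_def[of i])
  qed
  have "?f *v v = (\<Sum>k=1..r. indet (\<rho> k) (\<gamma> k) *v v)" for v
    unfolding diag_form_def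
    by (induction r) (simp_all add: matrix_vector_mult_add_rdistrib)
  then have f: "(?f *v v) $ i = (\<Sum>k=1..r. if i = \<rho> k then v $ \<gamma> k else 0)" for v i
    by (simp add: entry)
  have \<rho>k: "(?f *v v) $ \<rho> k = v $ \<gamma> k" if "k \<in> {1..r}" for v k
  proof -
    have "(?f *v v) $ \<rho> k = (\<Sum>k'=1..r. if k' = k then v $ \<gamma> k else 0)"
      unfolding f using that by (intro sum.cong) (auto dest: inj_onD[OF \<rho>])
    then show ?thesis using that by simp
  qed
  have "?f *v v = 0 \<longleftrightarrow> (\<forall>j\<in>\<gamma> ` {1..r}. v $ j = 0)" for v
  proof
    assume "?f *v v = 0"
    then show "\<forall>j\<in>\<gamma> ` {1..r}. v $ j = 0"
      using \<rho>k[of _ v] by (metis imageE zero_index)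
  next
    assume "\<forall>j\<in>\<gamma> ` {1..r}. v $ j = 0"
    then show "?f *v v = 0" by (auto simp: vec_eq_iff f intro!: sum.neutral)
  qed
  then have eq: "{v. ?f *v v \<noteq> 0} = - {v. \<forall>j\<in>\<gamma> ` {1..r}. v $ j = 0}" by auto
  have "CARD('a) ^ r * card {v :: 'a ^ 'm. \<forall>j\<in>\<gamma> ` {1..r}. v $ j = 0}
      = CARD('a) ^ r * CARD('a) ^ (CARD('m) - r)"
    using card_vanishing_coordinates[of "\<gamma> ` {1..r}", where ?'a = 'a] \<gamma> r
    by (simp add: card_image flip: power_add)
  then have "card {v :: 'a ^ 'm. \<forall>j\<in>\<gamma> ` {1..r}. v $ j = 0} = CARD('a) ^ (CARD('m) - r)"
    by simp
  then have "card {v. ?f *v v \<noteq> 0} = CARD('a) ^ CARD('m) - CARD('a) ^ (CARD('m) - r)"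
    by (simp only: eq) (simp add: Compl_eq_Diff_UNIV card_Diff_subset)
  also have "\<dots> = CARD('a) ^ (CARD('m) - r) * (CARD('a) ^ r - 1)"
    using r by (simp add: algebra_simps flip: power_add)
  finally show ?thesis unfolding hamming_weight_codeword[OF reps] power_add by simp
qed

section \<open>Generalized Hamming weights of the code\<close>

lemma diff_one_mult_sum_power:
  fixes q :: nat
  assumes "1 \<le> q"
  shows "(q - 1) * (\<Sum>k<r. q ^ k) = q ^ r - 1"
proof -
  have "int ((q - 1) * (\<Sum>k<r. q ^ k)) = int (q ^ r - 1)"
    using assms power_diff_1_eq[of "int q" r] by (simp add: of_nat_diff)
  then show ?thesis by (simp only: of_nat_eq_iff)
qed

lemma generalized_hamming_weight_det_code:
  fixes Mh :: "'n::finite \<Rightarrow> 'a::{field, finite} ^ 'm::finite ^ 'l::finite"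
  assumes reps: "rank_one_representatives Mh" and r: "1 \<le> r" "r \<le> CARD('m)"
  shows "generalized_hamming_weight r (det_code Mh)
    = CARD('a) ^ (CARD('l) - 1 + (CARD('m) - r)) * (\<Sum>k<r. CARD('a) ^ k)"
proof -
  let ?q = "CARD('a)"
  define d where "d = ?q ^ (CARD('l) - 1 + (CARD('m) - 1))"
  define S where "S = ?q ^ (CARD('l) - 1 + (CARD('m) - r)) * (\<Sum>k<r. ?q ^ k)"
  obtain k where k: "r = Suc k" using r by (cases r) auto
  have q: "1 < ?q" by (rule one_less_CARD_field)
  have "(?q - 1) * ?q ^ k * S
      = ?q ^ (CARD('l) - 1 + (CARD('m) - r)) * ?q ^ k * ((?q - 1) * (\<Sum>k<r. ?q ^ k))"
    by (simp add: S_def mult_ac)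
  also have "(?q - 1) * (\<Sum>k<r. ?q ^ k) = ?q ^ r - 1"
    using q by (intro diff_one_mult_sum_power) simp
  also have "?q ^ (CARD('l) - 1 + (CARD('m) - r)) * ?q ^ k = d"
  proof -
    have "CARD('l) - 1 + (CARD('m) - r) + k = CARD('l) - 1 + (CARD('m) - 1)" using r k zero_less_card_finite[where ?'a = 'l] by linarith
    then show ?thesis by (simp only: d_def flip: power_add)
  qed
  finally have S: "(?q - 1) * ?q ^ k * S = (?q ^ r - 1) * d" by (simp add: mult.commute)
  have card_D: "card (D - {0}) = ?q ^ r - 1" if "vec.subspace D" "vec.dim D = r" for D :: "('a ^ 'n) set"
    using that card_subspace[of D] by (simp add: card_Diff_singleton vec.subspace_0)
  have lower: "S \<le> support_weight D"
    if D: "vec.subspace D" "D \<subseteq> det_code Mh" "vec.dim D = r" for D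
  proof -
    have "d \<le> hamming_weight c" if c: "c \<in> D - {0}" for c
    proof -
      obtain f where f: "c = codeword Mh f" using c D unfolding det_code_def by auto
      have "codeword Mh 0 = 0" by (simp add: codeword_def eval_form_def vec_eq_iff)
      then have "f \<noteq> 0" using c f by auto
      then show ?thesis unfolding d_def f by (rule hamming_weight_codeword_ge[OF reps])
    qed
    then have "(?q ^ r - 1) * d \<le> (\<Sum>c\<in>D - {0}. hamming_weight c)"
      using sum_bounded_below[of "D - {0}" d hamming_weight] card_D D by simp
    then have "(?q - 1) * ?q ^ k * S \<le> (?q - 1) * ?q ^ k * support_weight D"
      using sum_hamming_weight_subspace[of D k] D k S by simp
    then show ?thesis using q by simp
  qed
  have "\<exists>D. vec.subspace D \<and> D \<subseteq> det_code Mh \<and> vec.dim D = r \<and> support_weight D = S"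
  proof -
    \<comment> \<open>An extremal subcode: \<open>r\<close> of the \<open>m\<close> unit vectors
      span a space of row vectors, which is placed into a single row of the coefficient
      matrix.\<close>
    obtain B :: "('a ^ 'm) set" where B: "B \<subseteq> cart_basis" "card B = r"
      using r obtain_subset_with_card_n[of r "cart_basis :: ('a ^ 'm) set"]
      by (auto simp: card_cart_basis)
    then have "vec.independent B" using independent_cart_basis vec.independent_mono by blast
    then have dimB: "vec.dim (vec.span B) = r" using B by (simp add: vec.dim_eq_card_independent)
    \<comment> \<open>Here \<open>undefined\<close> is merely some fixed row index.\<close>
    define g where "g w = codeword Mh (axis (undefined :: 'l) w)" for w
    have axis: "axis i (x + y) = axis i x + axis i y" "axis i (c *s x) $ k = c *s axis i x $ k"
      for i k :: 'l and x y :: "'a ^ 'm" and c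
      by (auto simp: axis_def vec_eq_iff)
    have lin: "Vector_Spaces.linear (*s) (*s) g"
      by unfold_locales
        (auto simp: g_def codeword_def eval_form_def axis vec_eq_iff sum.distrib sum_distrib_left algebra_simps)
    have wt: "hamming_weight (g w) = d" if "w \<noteq> 0" for w
      unfolding g_def d_def by (rule hamming_weight_codeword_axis[OF reps that])
    \<comment> \<open>Since nonzero \<open>w\<close> give words of positive weight, \<open>g\<close>
      is injective and preserves the dimension.\<close>
    have "d \<noteq> 0" using q by (simp add: d_def)
    then have g0: "w = 0" if "g w = 0" for w
      using wt[of w] that by (cases "w = 0") (auto simp: hamming_weight_def)
    interpret g: Vector_Spaces.linear "(*s)" "(*s)" g by (rule lin)
    have inj: "inj_on g A" for A
    proof (rule inj_onI)
      fix x y assume "g x = g y"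
      then have "g (x - y) = 0" by (simp add: g.diff)
      then show "x = y" using g0 by fastforce
    qed
    define D where "D = g ` vec.span B"
    have D: "vec.subspace D" unfolding D_def by (intro g.subspace_image) simp
    have dimD: "vec.dim D = r"
      unfolding D_def using vec.dim_image_eq[OF lin inj, of "vec.span B"] dimB by simp
    have "(\<Sum>c\<in>D - {0}. hamming_weight c) = (\<Sum>c\<in>D - {0}. d)"
      by (intro sum.cong) (auto simp: D_def g.zero intro!: wt)
    then have "(?q - 1) * ?q ^ k * support_weight D = (?q - 1) * ?q ^ k * S"
      using sum_hamming_weight_subspace[of D k] D dimD k S card_D by simp
    then have "support_weight D = S" using q by simp
    moreover have "D \<subseteq> det_code Mh" by (auto simp: D_def g_def det_code_def)
    ultimately show ?thesis using D dimD by blast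
  qed
  then show ?thesis
    unfolding generalized_hamming_weight_def S_def[symmetric] setcompr_eq_image
    by (intro Min_eqI) (use lower in auto)
qed

theorem theorem4p4:
  fixes Mh :: "'n::finite \<Rightarrow> 'a::{field, finite} ^ 'm::finite ^ 'l::finite"
    and \<rho> :: "nat \<Rightarrow> 'l" and \<gamma> :: "nat \<Rightarrow> 'm"
    and q l m r :: nat
  assumes q: "q = CARD('a)"
    and l: "l = CARD('l)"
    and m: "m = CARD('m)"
    and lm: "1 \<le> l" "l \<le> m"
    and reps: "rank_one_representatives Mh"
    and row: "bij_betw \<rho> {1..l} UNIV"
    and col: "bij_betw \<gamma> {1..m} UNIV"
    and r: "1 \<le> r" "r \<le> m"
  shows "int (generalized_hamming_weight r (det_code Mh)) = griesmer_wei_bound r (det_code Mh)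
    \<and> generalized_hamming_weight r (det_code Mh) = (\<Sum>k = l + m - r - 1..l + m - 2. q ^ k)
    \<and> real (generalized_hamming_weight r (det_code Mh))
        = real q ^ (l + m - r - 1) * ((real q ^ r - 1) / (real q - 1))
    \<and> (r \<le> l \<longrightarrow>
        generalized_hamming_weight r (det_code Mh)
          = hamming_weight (codeword Mh (diag_form \<rho> \<gamma> r)))"
proof -
  let ?d = "generalized_hamming_weight r (det_code Mh)"
  define e where "e = l + m - r - 1"
  \<comment> \<open>The exponent \<open>e\<close> is the smallest in the sum of powers and
    \<open>e + r - 1\<close> the largest; the latter is also the exponent of the minimum
    distance.\<close>
  have e: "l - 1 + (m - r) = e" and e1: "l - 1 + (m - 1) = e + r - 1" and e2: "l + m - 2 = e + r - 1"
    using lm r by (auto simp: e_def)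
  have q1: "1 < q" unfolding q by (rule one_less_CARD_field)
  have d: "?d = q ^ e * (\<Sum>k<r. q ^ k)"
    using generalized_hamming_weight_det_code[OF reps, of r] r unfolding q l m e[symmetric] by simp
  have d1: "generalized_hamming_weight 1 (det_code Mh) = q ^ (e + r - 1)"
    using generalized_hamming_weight_det_code[OF reps, of 1] r unfolding q m e1[symmetric] l by simp
  have sum_eq: "?d = (\<Sum>k=e..e + r - 1. q ^ k)"
  proof -
    have "(\<Sum>k=e..e + r - 1. q ^ k) = (\<Sum>k\<in>{0 + e..<r + e}. q ^ k)"
      using r by (intro sum.cong) auto
    also have "\<dots> = q ^ e * (\<Sum>k<r. q ^ k)"
      by (simp only: sum.shift_bounds_nat_ivl)
        (simp add: power_add sum_distrib_left mult.commute lessThan_atLeast0)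
    finally show ?thesis by (simp add: d)
  qed
  have "griesmer_wei_bound r (det_code Mh) = (\<Sum>j<r. int (q ^ (e + r - Suc j)))"
    unfolding griesmer_wei_bound_def d1 q[symmetric]
  proof (intro sum.cong refl)
    fix j assume j: "j \<in> {..<r}"
    \<comment> \<open>As \<open>j < r\<close>, the power \<open>q^j\<close> divides the minimum
      distance, so the ceiling is exact.\<close>
    then have "e + r - 1 = (e + r - Suc j) + j" by auto
    then have "real (q ^ (e + r - 1)) = real (q ^ (e + r - Suc j)) * real (q ^ j)"
      by (metis of_nat_mult power_add)
    then have "real (q ^ (e + r - 1)) / real (q ^ j) = real (q ^ (e + r - Suc j))"
      using q1 by simp
    then show "\<lceil>real (q ^ (e + r - 1)) / real (q ^ j)\<rceil> = int (q ^ (e + r - Suc j))"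
      by (simp only: ceiling_of_nat)
  qed
  also have "\<dots> = int (q ^ e * (\<Sum>j<r. q ^ (r - Suc j)))"
    by (simp add: sum_distrib_left flip: power_add)
  \<comment> \<open>The bound lists the powers in descending order; reversing the summation matches
    the formula for the weight.\<close>
  also have "(\<Sum>j<r. q ^ (r - Suc j)) = (\<Sum>j<r. q ^ j)"
    by (rule sum.nat_diff_reindex)
  finally have griesmer: "int ?d = griesmer_wei_bound r (det_code Mh)" by (simp add: d)
  have "real ?d = real q ^ e * ((real q ^ r - 1) / (real q - 1))"
    using q1 by (simp add: d sum_gp_strict sum_gp0 field_simps)
  moreover have "?d = hamming_weight (codeword Mh (diag_form \<rho> \<gamma> r))" if "r \<le> l"
  proof -
    have "inj_on \<rho> {1..r}" "inj_on \<gamma> {1..r}"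
      using row col that r by (auto simp: bij_betw_def elim!: inj_on_subset)
    then have "(q - 1) * hamming_weight (codeword Mh (diag_form \<rho> \<gamma> r)) = q ^ e * (q ^ r - 1)"
      using hamming_weight_codeword_diag_form[OF reps] r unfolding q l m e[symmetric] by simp
    \<comment> \<open>By the geometric sum, both weights have the same multiple by
      \<open>q - 1\<close>, which is positive and cancels.\<close>
    also have "\<dots> = (q - 1) * ?d"
      using diff_one_mult_sum_power[of q r] q1 by (simp add: d mult.left_commute)
    finally show ?thesis using q1 by simp
  qed
  ultimately show ?thesis
    using griesmer sum_eq unfolding e2 e_def[symmetric] by blast
qed

end
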